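(* Let $\mathcal{H}$ be a separable complex Hilbert space, let $A$ be a bounded linear operator on $\mathcal{H}$, and let $G\subset\mathcal{H}$. If $\dim\mathcal{H}=\infty$, $|G|<\infty$, and the system $\{A^n g\}_{g\in G,\, n\ge 0}$ satisfies the lower frame bound in $\mathcal{H}$, then $\|A\|\ge 1$.
   Context: The system $\{A^n g\}_{g\in G,\,n\ge 0}$ is regarded as a family indexed by pairs $(g,n)$ with $g\in G$, $n\in\{0,1,2,\dots\}$. It satisfies the lower frame bound in $\mathcal{H}$ if there is a constant $C_1>0$ such that $C_1\|f\|^2\le \sum_{g\in G}\sum_{n=0}^\infty |\langle f, A^n g\rangle|^2$ for all $f\in\mathcal{H}$ (the sum is allowed to be $+\infty$). $|G|$ denotes the cardinality of $G$. *)

theory Defs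
  imports "HOL-Analysis.Analysis"
begin

text \<open>
  Complex Hilbert spaces are built on top of the library's real inner product spaces: the
  real part of the complex inner product is required to be the underlying real inner product,
  so that the norm, the metric and the topology of the type are the ones induced by the complex
  inner product (lemma \<open>cinner_self\<close>).  The complex inner product is linear in its first argument.
\<close>

class complex_inner = real_inner +
  fixes scaleC :: "complex \<Rightarrow> 'a \<Rightarrow> 'a"  (infixr "*\<^sub>C" 75)
    and cinner :: "'a \<Rightarrow> 'a \<Rightarrow> complex"
  assumes scaleC_add_right: "a *\<^sub>C (x + y) = a *\<^sub>C x + a *\<^sub>C y"
    and scaleC_add_left: "(a + b) *\<^sub>C x = a *\<^sub>C x + b *\<^sub>C x"
    and scaleC_scaleC: "a *\<^sub>C b *\<^sub>C x = (a * b) *\<^sub>C x"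
    and scaleC_of_real: "complex_of_real r *\<^sub>C x = scaleR r x"
    and cinner_commute: "cinner x y = cnj (cinner y x)"
    and cinner_add_left: "cinner (x + y) z = cinner x z + cinner y z"
    and cinner_scaleC_left: "cinner (a *\<^sub>C x) y = a * cinner x y"
    and Re_cinner: "Re (cinner x y) = inner x y"

class chilbert_space = complex_inner + complete_space

lemma cinner_self:
  fixes x :: "'a::complex_inner"
  shows "cinner x x = complex_of_real ((norm x)\<^sup>2)"
proof (rule complex_eqI)
  show "Re (cinner x x) = Re (complex_of_real ((norm x)\<^sup>2))"
    by (simp add: Re_cinner power2_norm_eq_inner)
  have "Im (cinner x x) = - Im (cinner x x)"
    using arg_cong[OF cinner_commute[of x x], of Im] by simp
  then show "Im (cinner x x) = Im (complex_of_real ((norm x)\<^sup>2))"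
    by simp
qed

global_interpretation cvec: vector_space "scaleC :: complex \<Rightarrow> 'a \<Rightarrow> 'a::complex_inner"
proof
  show "1 *\<^sub>C x = x" for x :: 'a
    using scaleC_of_real[of 1 x] by simp
qed (simp_all add: scaleC_add_right scaleC_add_left scaleC_scaleC)

instantiation complex :: chilbert_space
begin

definition scaleC_complex :: "complex \<Rightarrow> complex \<Rightarrow> complex"
  where "scaleC_complex a x = a * x"

definition cinner_complex :: "complex \<Rightarrow> complex \<Rightarrow> complex"
  where "cinner_complex x y = x * cnj y"

instance
  by standard (simp_all add: scaleC_complex_def cinner_complex_def inner_complex_def
      algebra_simps scaleR_conv_of_real)

end

text \<open>The dimension is the algebraic one over the complex numbers; a Hilbert space has infinite
  algebraic dimension if and only if it has infinite Hilbert dimension.\<close>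

definition infinite_cdim :: "'a::complex_inner itself \<Rightarrow> bool"
  where "infinite_cdim _ \<longleftrightarrow> \<not> (\<exists>B::'a set. finite B \<and> cvec.span B = UNIV)"

definition bounded_clinear :: "('a::complex_inner \<Rightarrow> 'b::complex_inner) \<Rightarrow> bool"
  where "bounded_clinear A \<longleftrightarrow> bounded_linear A \<and> (\<forall>c x. A (c *\<^sub>C x) = c *\<^sub>C A x)"

text \<open>Both sums are taken in the extended nonnegative reals, so they always exist and may be
  infinite, for arbitrary \<open>G\<close>.\<close>

definition orbit_lower_frame_bound ::
    "('a::complex_inner \<Rightarrow> 'a) \<Rightarrow> 'a set \<Rightarrow> bool"
  where "orbit_lower_frame_bound A G \<longleftrightarrow>
    (\<exists>C>0::real. \<forall>f.
      ennreal (C * (norm f)\<^sup>2) \<le> (\<Sum>\<^sub>\<infinity>g\<in>G. \<Sum>n. ennreal ((cmod (cinner f ((A ^^ n) g)))\<^sup>2)))"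

end

theory Submission
  imports Defs
begin

text \<open>
  Suppose \<open>a = \<parallel>A\<parallel> < 1\<close>.  The orbit vectors \<open>A\<^sup>n g\<close> decay geometrically, so for large \<open>N\<close> the part of the
  frame sum with \<open>n \<ge> N\<close> is at most \<open>\<epsilon> \<parallel>f\<parallel>\<^sup>2\<close> with \<open>\<epsilon>\<close> below the lower frame constant \<open>C\<close>.  The rest of
  the system consists of finitely many vectors, since \<open>G\<close> is finite.  In infinite dimension some
  nonzero \<open>f\<close> is orthogonal to all of them (\<open>exists_nonzero_orthogonal\<close>), and for this \<open>f\<close> the frame
  sum consists of the tail alone (\<open>orbit_sum_le_of_orthogonal\<close>), hence is smaller than \<open>C \<parallel>f\<parallel>\<^sup>2\<close>:
  the lower frame bound fails.
\<close>

lemma norm_scaleC: "norm (c *\<^sub>C x) = cmod c * norm x" for x :: "'a::complex_inner"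
proof -
  have "cinner (c *\<^sub>C x) (c *\<^sub>C x) = c * cnj (c * cinner x x)"
    by (metis cinner_commute cinner_scaleC_left)
  also have "\<dots> = complex_of_real ((cmod c * norm x)\<^sup>2)"
    by (simp add: cinner_self power_mult_distrib complex_norm_square mult.assoc del: of_real_power)
  finally have "(norm (c *\<^sub>C x))\<^sup>2 = (cmod c * norm x)\<^sup>2"
    by (simp only: cinner_self of_real_eq_iff)
  then show ?thesis
    by (simp add: power2_eq_iff_nonneg)
qed

text \<open>Rotating \<open>x\<close> by the phase that makes \<open>cinner x y\<close> real and nonnegative reduces the inequality
  to the real Cauchy-Schwarz inequality.\<close>

lemma cinner_Cauchy_Schwarz: "cmod (cinner x y) \<le> norm x * norm y" for x y :: "'a::complex_inner"
proof -
  define u where "u = cnj (sgn (cinner x y))"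
  have "u * cinner x y = complex_of_real (cmod (cinner x y))"
    by (simp add: u_def sgn_div_norm scaleR_conv_of_real complex_norm_square[symmetric]
        mult.commute power2_eq_square field_simps)
  then have "cmod (cinner x y) = inner (u *\<^sub>C x) y"
    by (metis Re_cinner Re_complex_of_real cinner_scaleC_left)
  also have "\<dots> \<le> norm (u *\<^sub>C x) * norm y"
    by (rule norm_cauchy_schwarz)
  also have "\<dots> \<le> norm x * norm y"
    by (intro mult_right_mono) (auto simp: norm_scaleC u_def norm_sgn)
  finally show ?thesis .
qed

lemma cinner_diff_left: "cinner (x - y) z = cinner x z - cinner y z" for x y z :: "'a::complex_inner"
  using cinner_add_left[of "x - y" y z] by simp

text \<open>The orthogonal complement of a finite set has finite codimension.  Each new vector \<open>s\<close> imposes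
  one linear condition on the complement \<open>W\<close> found so far.  Either that condition holds on all of
  \<open>W\<close>, or some \<open>w \<in> W\<close> violates it, and then the single extra direction \<open>w\<close> suffices to correct every
  element of \<open>W\<close>.\<close>

lemma finite_codim_orthogonal_complement:
  fixes S :: "'a::complex_inner set"
  assumes "finite S"
  shows "\<exists>B. finite B \<and> (\<forall>x. \<exists>y\<in>cvec.span B. \<forall>s\<in>S. cinner (x - y) s = 0)"
  using assms
proof (induction S rule: finite_induct)
  case empty
  show ?case
    by (auto intro!: exI[of _ "{}"])
next
  case (insert s S)
  then obtain B where B: "finite B" "\<forall>x. \<exists>y\<in>cvec.span B. \<forall>s\<in>S. cinner (x - y) s = 0"
    by blast
  show ?case
  proof (cases "\<exists>w. (\<forall>t\<in>S. cinner w t = 0) \<and> cinner w s \<noteq> 0")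
    case False
    with B show ?thesis
      by (metis insert_iff)
  next
    case True
    then obtain w where w: "\<forall>t\<in>S. cinner w t = 0" "cinner w s \<noteq> 0"
      by blast
    have "\<exists>y\<in>cvec.span (insert w B). \<forall>t\<in>insert s S. cinner (x - y) t = 0" for x
    proof -
      obtain y where y: "y \<in> cvec.span B" "\<forall>t\<in>S. cinner (x - y) t = 0"
        using B by blast
      define c where "c = cinner (x - y) s / cinner w s"
      have split: "cinner (x - (y + c *\<^sub>C w)) t = cinner (x - y) t - c * cinner w t" for t
        by (simp add: cinner_diff_left cinner_add_left cinner_scaleC_left)
      have "y \<in> cvec.span (insert w B)"
        using y(1) cvec.span_mono[of B "insert w B"] by blast
      then have "y + c *\<^sub>C w \<in> cvec.span (insert w B)"
        by (intro cvec.span_add cvec.span_scale) (auto intro: cvec.span_base)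
      moreover have "\<forall>t\<in>insert s S. cinner (x - (y + c *\<^sub>C w)) t = 0"
        using y(2) w by (simp add: split) (simp add: c_def)
      ultimately show ?thesis
        by blast
    qed
    with B(1) show ?thesis
      by (intro exI[of _ "insert w B"]) auto
  qed
qed

lemma exists_nonzero_orthogonal:
  fixes S :: "'a::complex_inner set"
  assumes "infinite_cdim TYPE('a)" and "finite S"
  shows "\<exists>f. f \<noteq> 0 \<and> (\<forall>s\<in>S. cinner f s = 0)"
proof (rule ccontr)
  assume trivial: "\<not> ?thesis"
  obtain B where B: "finite B" "\<And>x. \<exists>y\<in>cvec.span B. \<forall>s\<in>S. cinner (x - y) s = 0"
    using finite_codim_orthogonal_complement[OF assms(2)] by blast
  have "x \<in> cvec.span B" for x
    using B(2)[of x] trivial by (metis eq_iff_diff_eq_0)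
  with B(1) assms(1) show False
    by (auto simp: infinite_cdim_def)
qed

lemma norm_funpow_le:
  fixes A :: "'a::real_normed_vector \<Rightarrow> 'a"
  assumes "bounded_linear A"
  shows "norm ((A ^^ n) x) \<le> onorm A ^ n * norm x"
proof (induction n)
  case (Suc n)
  have "norm (A ((A ^^ n) x)) \<le> onorm A * norm ((A ^^ n) x)"
    by (rule onorm[OF assms])
  also have "\<dots> \<le> onorm A * (onorm A ^ n * norm x)"
    by (intro mult_left_mono Suc.IH onorm_pos_le[OF assms])
  finally show ?case
    by (simp add: mult.assoc)
qed simp

text \<open>With \<open>a = \<parallel>A\<parallel>\<close>, the \<open>n\<close>-th term is at most \<open>\<parallel>f\<parallel>\<^sup>2 \<parallel>g\<parallel>\<^sup>2 a\<^sup>2\<^sup>n\<close> and it vanishes for \<open>n < N\<close>.  Replacing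
  \<open>a\<^sup>2\<^sup>n\<close> by the larger \<open>a\<^sup>N a\<^sup>n\<close> for \<open>n \<ge> N\<close> gives a geometric majorant that is valid for all \<open>n\<close>
  and still carries the small factor \<open>a\<^sup>N\<close>.\<close>

lemma orbit_sum_le_of_orthogonal:
  fixes A :: "'a::complex_inner \<Rightarrow> 'a"
  assumes A: "bounded_linear A" "onorm A < 1"
    and orth: "\<And>n. n < N \<Longrightarrow> cinner f ((A ^^ n) g) = 0"
  shows "(\<Sum>n. ennreal ((cmod (cinner f ((A ^^ n) g)))\<^sup>2))
    \<le> ennreal ((norm f)\<^sup>2 * (norm g)\<^sup>2 * onorm A ^ N / (1 - onorm A))"
proof -
  define a where "a = onorm A"
  have a: "0 \<le> a" "a < 1"
    using A onorm_pos_le by (auto simp: a_def)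
  define K where "K = (norm f)\<^sup>2 * (norm g)\<^sup>2 * a ^ N"
  have K: "0 \<le> K"
    using a by (simp add: K_def)
  have bound: "(cmod (cinner f ((A ^^ n) g)))\<^sup>2 \<le> K * a ^ n" for n
  proof (cases "n < N")
    case True
    with K a show ?thesis
      by (simp add: orth)
  next
    case False
    have "cmod (cinner f ((A ^^ n) g)) \<le> norm f * (a ^ n * norm g)"
      using cinner_Cauchy_Schwarz norm_funpow_le[OF A(1), folded a_def]
      by (meson mult_left_mono norm_ge_zero order_trans)
    then have "(cmod (cinner f ((A ^^ n) g)))\<^sup>2 \<le> (norm f * (a ^ n * norm g))\<^sup>2"
      by (intro power_mono) auto
    also have "\<dots> = (norm f)\<^sup>2 * (norm g)\<^sup>2 * (a ^ n * a ^ n)"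
      by (simp add: power2_eq_square)
    also have "\<dots> \<le> (norm f)\<^sup>2 * (norm g)\<^sup>2 * (a ^ N * a ^ n)"
      using False a by (intro mult_left_mono mult_right_mono power_decreasing) auto
    finally show ?thesis
      by (simp add: K_def mult.assoc)
  qed
  have "(\<lambda>n. K * a ^ n) sums (K / (1 - a))"
    using sums_mult[OF geometric_sums[of a], of K] a by simp
  then have "(\<Sum>n. ennreal (K * a ^ n)) = ennreal (K / (1 - a))"
    using K a by (intro suminf_ennreal_eq) auto
  moreover have "(\<Sum>n. ennreal ((cmod (cinner f ((A ^^ n) g)))\<^sup>2)) \<le> (\<Sum>n. ennreal (K * a ^ n))"
    by (intro suminf_le ennreal_leI bound) auto
  ultimately show ?thesis
    by (simp add: K_def a_def)
qed

theorem theorem9: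
  fixes A :: "'a::chilbert_space \<Rightarrow> 'a" and G :: "'a set"
  assumes "separable_space (euclidean :: 'a topology)"
    and "bounded_clinear A"
    and "infinite_cdim TYPE('a)"
    and "finite G"
    and "orbit_lower_frame_bound A G"
  shows "onorm A \<ge> 1"
proof (rule ccontr)
  assume "\<not> ?thesis"
  then have less1: "onorm A < 1"
    by simp
  have lin: "bounded_linear A"
    using assms(2) by (simp add: bounded_clinear_def)
  have nonneg: "0 \<le> onorm A"
    by (rule onorm_pos_le[OF lin])
  obtain C where C: "C > 0" "\<And>f. ennreal (C * (norm f)\<^sup>2)
      \<le> (\<Sum>\<^sub>\<infinity>g\<in>G. \<Sum>n. ennreal ((cmod (cinner f ((A ^^ n) g)))\<^sup>2))"
    using assms(5) by (auto simp: orbit_lower_frame_bound_def)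
  define M where "M = (\<Sum>g\<in>G. (norm g)\<^sup>2) / (1 - onorm A)"
  have "(\<lambda>N. M * onorm A ^ N) \<longlonglongrightarrow> M * 0"
    using nonneg less1 by (intro tendsto_mult_left LIMSEQ_realpow_zero)
  then have "\<forall>\<^sub>F N in sequentially. M * onorm A ^ N < C"
    using C(1) by (intro order_tendstoD(2)[where y = "M * 0"]) auto
  then obtain N where N: "M * onorm A ^ N < C"
    by (auto simp: eventually_sequentially)
  define S where "S = (\<lambda>(n, g). (A ^^ n) g) ` ({..<N} \<times> G)"
  have "finite S"
    using assms(4) by (simp add: S_def)
  obtain f where f: "f \<noteq> 0" "\<And>s. s \<in> S \<Longrightarrow> cinner f s = 0"
    using exists_nonzero_orthogonal[OF assms(3) \<open>finite S\<close>] by blast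
  have "ennreal (C * (norm f)\<^sup>2)
      \<le> (\<Sum>g\<in>G. \<Sum>n. ennreal ((cmod (cinner f ((A ^^ n) g)))\<^sup>2))"
    using C(2)[of f] assms(4) by simp
  also have "\<dots> \<le> (\<Sum>g\<in>G. ennreal ((norm f)\<^sup>2 * (norm g)\<^sup>2 * onorm A ^ N / (1 - onorm A)))"
    by (intro sum_mono orbit_sum_le_of_orthogonal lin less1 f(2)) (auto simp: S_def)
  also have "\<dots> = ennreal (\<Sum>g\<in>G. (norm f)\<^sup>2 * (norm g)\<^sup>2 * onorm A ^ N / (1 - onorm A))"
    using nonneg less1 by (intro sum_ennreal) simp
  also have "(\<Sum>g\<in>G. (norm f)\<^sup>2 * (norm g)\<^sup>2 * onorm A ^ N / (1 - onorm A))
      = M * onorm A ^ N * (norm f)\<^sup>2"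
    by (simp add: M_def sum_distrib_left sum_distrib_right sum_divide_distrib mult_ac)
  finally have "ennreal (C * (norm f)\<^sup>2) \<le> ennreal (M * onorm A ^ N * (norm f)\<^sup>2)" .
  moreover have "ennreal (M * onorm A ^ N * (norm f)\<^sup>2) < ennreal (C * (norm f)\<^sup>2)"
    using N C(1) f(1) by (intro ennreal_lessI) auto
  ultimately show False
    by (simp add: leD)
qed

end
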